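(* Let $m$ be a positive even integer, let $s\ge1$, let $a_1,\dots,a_s\ge0$ be integers, put $a=\sum_{i=1}^s(a_i+1)$, and assume $n:=m-a\ge 1$. For each $i$ let $c_i\in\tfrac12\mathbb{Z}$ with $c_i-a_i/2\in\mathbb{Z}$ and let $A_i=\{c_i-a_i/2,\dots,c_i+a_i/2\}$; assume $A_1,\dots,A_s$ are pairwise disjoint subsets of $\{1,\dots,n+1\}$. For an integer $k$ with $0\le k\le\min_i a_i$, let $G_k$ be the induced subgraph of $AR_{m,n}$ on the white cells $(i,j)$ with $k\le i\le 2m-k$ and $k\le j\le 2n-k$ (a translate of $AR_{m-k,n-k}$) that do not belong to any of the copies of $O_{k,\,a_i-k}$ centered at $(m+1,\;2c_i-2)$, $i=1,\dots,s$. (In particular $G_0$ is $AR_{m,n}$ with the cells $(m+1,2t-2)$, $t\in A_1\cup\dots\cup A_s$, deleted.) Then for every integer $k$ with $1\le k\le\min_i a_i$, $$\mathrm{M}(G_k)=2^{\binom{k+1}{2}(s+1)-k(m+1)}\,\mathrm{M}(G_0).$$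
   Context: For integers $M,N\ge 0$ let $B_{M,N}=\{0,1,\dots,2M\}\times\{0,1,\dots,2N\}$; an element $(i,j)$ (row $i$, column $j$) is a cell, black if $i+j$ is even and white if $i+j$ is odd. The Aztec rectangle graph $AR_{M,N}$ has as vertices the white cells of $B_{M,N}$, two cells $(i,j),(i',j')$ being adjacent iff $|i-i'|=|j-j'|=1$. For integers $K,L\ge0$ and $(x,y)\in\mathbb{Z}^2$ with $x+y+K+L$ odd, the copy of the odd Aztec rectangle $O_{K,L}$ centered at $(x,y)$ is the set of cells $\{(x+r,y+t): |r|\le K,\ |t|\le L,\ r+t\equiv K+L \pmod 2\}$; all its cells are white. $\mathrm{M}(G)$ denotes the number of perfect matchings of $G$ (equivalently, domino tilings of the dual region). In the paper the right-hand side is also written via the graph $R'''(m,n;\cdot)$, which is $G_0$. *)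

theory Defs
  imports Complex_Main "HOL-Library.Disjoint_Sets"
begin

text \<open>A simple graph is a pair of its vertex set and its set of two-element edges.\<close>

type_synonym 'a graph = "'a set \<times> 'a set set"

definition induced_subgraph :: "'a graph \<Rightarrow> 'a set \<Rightarrow> 'a graph" where
  "induced_subgraph G U = (fst G \<inter> U, {e \<in> snd G. e \<subseteq> U})"

definition perfect_matching :: "'a graph \<Rightarrow> 'a set set \<Rightarrow> bool" where
  "perfect_matching G P \<longleftrightarrow> P \<subseteq> snd G \<and> (\<forall>v\<in>fst G. \<exists>!e. e \<in> P \<and> v \<in> e)"

definition num_perfect_matchings :: "'a graph \<Rightarrow> nat" where
  "num_perfect_matchings G = card {P. perfect_matching G P}"

type_synonym cell = "int \<times> int"

definition white_cells :: "nat \<Rightarrow> nat \<Rightarrow> cell set" where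
  "white_cells M N = {(i, j). 0 \<le> i \<and> i \<le> 2 * int M \<and> 0 \<le> j \<and> j \<le> 2 * int N \<and> odd (i + j)}"

definition diag_adjacent :: "cell \<Rightarrow> cell \<Rightarrow> bool" where
  "diag_adjacent p q \<longleftrightarrow> \<bar>fst p - fst q\<bar> = 1 \<and> \<bar>snd p - snd q\<bar> = 1"

definition aztec_rectangle :: "nat \<Rightarrow> nat \<Rightarrow> cell graph" where
  "aztec_rectangle M N =
     (white_cells M N,
      {{p, q} | p q. p \<in> white_cells M N \<and> q \<in> white_cells M N \<and> diag_adjacent p q})"

definition odd_aztec_rectangle :: "nat \<Rightarrow> nat \<Rightarrow> cell \<Rightarrow> cell set" where
  "odd_aztec_rectangle K L ctr =
     {(fst ctr + r, snd ctr + t) | r t.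
        \<bar>r\<bar> \<le> int K \<and> \<bar>t\<bar> \<le> int L \<and> (r + t) mod 2 = (int K + int L) mod 2}"

text \<open>The set \<open>{c - l/2, c - l/2 + 1, \<dots>, c + l/2}\<close>, for \<open>c - l/2\<close> an integer.\<close>

definition centered_block :: "rat \<Rightarrow> nat \<Rightarrow> int set" where
  "centered_block c l =
     {t. c - of_nat l / 2 \<le> of_int t \<and> of_int t \<le> c + of_nat l / 2}"

text \<open>
  The graph \<open>G\<^sub>k\<close>. The centers \<open>c i\<close> are half-integers, so the floor of \<open>2 * c i\<close> is
  \<open>2 * c i\<close> itself, and \<open>k \<le> a i\<close> for all \<open>i\<close>, so the subtraction \<open>a i - k\<close> is not truncated.
\<close>

definition holey_aztec_rectangle ::
    "nat \<Rightarrow> nat \<Rightarrow> nat \<Rightarrow> (nat \<Rightarrow> nat) \<Rightarrow> (nat \<Rightarrow> rat) \<Rightarrow> nat \<Rightarrow> cell graph" where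
  "holey_aztec_rectangle m n s a c k =
     induced_subgraph (aztec_rectangle m n)
       ({(i, j). int k \<le> i \<and> i \<le> 2 * int m - int k \<and> int k \<le> j \<and> j \<le> 2 * int n - int k}
        - (\<Union>i\<in>{1..s}. odd_aztec_rectangle k (a i - k) (int m + 1, \<lfloor>2 * c i\<rfloor> - 2)))"

end

theory Submission
  imports Defs
begin

text \<open>
  The edges of \<open>G\<^sub>k\<close> split into the 4-cycles around the black cells \<open>(i, j)\<close> with \<open>i\<close> and \<open>j\<close> congruent
  to \<open>k + 1\<close> modulo 2, leaving out those inside the holes. A matching of \<open>G\<^sub>k\<close> covers, in each 4-cycle, a
  set \<open>S\<close> of vertices; replacing every \<open>S\<close> by its complement in the 4-cycle turns the matchings of \<open>G\<^sub>k\<close>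
  into those of \<open>G\<^bsub>k+1\<^esub>\<close>, because a vertex lies in as many of the 4-cycles as it lies in the two
  graphs. A 4-cycle has \<open>2\<^bsup>|S|/2 - 1\<^esup>\<close> times as many matchings covering exactly \<open>S\<close> as matchings
  covering exactly the complement of \<open>S\<close>. Hence
  \<open>M(G\<^sub>k) = 2\<^bsup>(|V\<^sub>k| - |V\<^sub>k\<^sub>+\<^sub>1|)/4\<^esup> M(G\<^bsub>k+1\<^esub>)\<close>, where \<open>V\<^sub>k\<close> is the vertex set of \<open>G\<^sub>k\<close>; this telescopes,
  and it remains to count \<open>V\<^sub>0\<close> and \<open>V\<^sub>k\<close>.
\<close>

section \<open>Decomposing matchings along a partition of the edges\<close>

text \<open>\<open>\<sigma> c\<close> is the set of vertices covered by the edges in \<open>D c\<close>.\<close>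

definition admissible :: "'c set \<Rightarrow> ('c \<Rightarrow> 'a set set) \<Rightarrow> 'a set \<Rightarrow> ('c \<Rightarrow> 'a set) set" where
  "admissible C D V =
     {\<sigma> \<in> Pi\<^sub>E C (\<lambda>c. Pow (\<Union> (D c))). \<forall>v. card {c \<in> C. v \<in> \<sigma> c} = of_bool (v \<in> V)}"

text \<open>The edge set is kept apart from the vertex set, so that two vertex sets can be compared
  over the same edges.\<close>

abbreviation span_graph :: "'a set set \<Rightarrow> 'a set \<Rightarrow> 'a graph" where
  "span_graph E V \<equiv> (V, {e \<in> E. e \<subseteq> V})"

text \<open>Covering all of \<open>V\<close> and using only edges inside \<open>V\<close> merge into
  \<open>\<Union> P = V\<close>; a matching thus determines the vertex set that it covers, inside
  each block as well.\<close>

lemma perfect_matching_span: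
  "perfect_matching (span_graph E V) P \<longleftrightarrow>
     P \<subseteq> E \<and> \<Union> P = V \<and> (\<forall>v e e'. e \<in> P \<longrightarrow> e' \<in> P \<longrightarrow> v \<in> e \<longrightarrow> v \<in> e' \<longrightarrow> e = e')"
  unfolding perfect_matching_def by simp blast

text \<open>Once the vertex set covered by each block of edges is prescribed, the choices in
  different blocks are independent, so each prescription contributes a product.\<close>

lemma num_perfect_matchings_decompose:
  fixes C :: "'c set" and D :: "'c \<Rightarrow> 'a set set"
  assumes C: "finite C" and disj: "disjoint_family_on D C"
    and fin: "\<And>c. c \<in> C \<Longrightarrow> finite (D c)" "\<And>c. c \<in> C \<Longrightarrow> finite (\<Union> (D c))"
  shows "num_perfect_matchings (span_graph (\<Union>c\<in>C. D c) V) =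
    (\<Sum>\<sigma> \<in> admissible C D V. \<Prod>c\<in>C. num_perfect_matchings (span_graph (D c) (\<sigma> c)))"
proof -
  define T where "T c S = {Q. perfect_matching (span_graph (D c) S) Q}" for c S
  have adm_fin: "finite (admissible C D V)"
    by (rule finite_subset[of _ "Pi\<^sub>E C (\<lambda>c. Pow (\<Union> (D c)))"])
      (use C fin in \<open>auto simp: admissible_def intro!: finite_PiE\<close>)
  have T_fin: "finite (T c S)" if "c \<in> C" for c S
    by (rule finite_subset[of _ "Pow (D c)"])
      (use fin that in \<open>auto simp: T_def perfect_matching_def\<close>)
  \<comment> \<open>A matching corresponds to its family of parts \<open>P \<inter> D c\<close>,
    tagged with the sets they cover. Both components are restricted to \<open>C\<close> because the
    target consists of extensional functions.\<close>
  have "bij_betw (\<lambda>P. (\<lambda>c\<in>C. \<Union> (P \<inter> D c), \<lambda>c\<in>C. P \<inter> D c))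
      {P. perfect_matching (span_graph (\<Union>c\<in>C. D c) V) P}
      (SIGMA \<sigma> : admissible C D V. Pi\<^sub>E C (\<lambda>c. T c (\<sigma> c)))"
  proof (rule bij_betw_byWitness[where f' = "\<lambda>(\<sigma>, Q). \<Union>c\<in>C. Q c"])
    show "\<forall>P \<in> {P. perfect_matching (span_graph (\<Union>c\<in>C. D c) V) P}.
        (\<lambda>(\<sigma>, Q). \<Union>c\<in>C. Q c) (\<lambda>c\<in>C. \<Union> (P \<inter> D c), \<lambda>c\<in>C. P \<inter> D c) = P"
      unfolding perfect_matching_span by auto
  next
    show "\<forall>x \<in> (SIGMA \<sigma> : admissible C D V. Pi\<^sub>E C (\<lambda>c. T c (\<sigma> c))).
        (\<lambda>P. (\<lambda>c\<in>C. \<Union> (P \<inter> D c), \<lambda>c\<in>C. P \<inter> D c)) ((\<lambda>(\<sigma>, Q). \<Union>c\<in>C. Q c) x) = x"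
    proof (clarsimp, intro conjI)
      fix \<sigma> Q assume \<sigma>: "\<sigma> \<in> admissible C D V" and Q: "Q \<in> Pi\<^sub>E C (\<lambda>c. T c (\<sigma> c))"
      have Qc: "Q c \<subseteq> D c" "\<Union> (Q c) = \<sigma> c" if "c \<in> C" for c
        using Q that unfolding T_def perfect_matching_span by (auto dest!: PiE_mem)
      have *: "(\<Union>x\<in>C. Q x) \<inter> D c = Q c" if "c \<in> C" for c
      proof -
        have "x = c" if "x \<in> C" "e \<in> Q x" "e \<in> D c" for x e
          using Qc(1)[of x] that \<open>c \<in> C\<close> disj unfolding disjoint_family_on_def by blast
        thus ?thesis using Qc(1)[OF that] that by blast
      qed
      show "(\<lambda>c\<in>C. \<Union> ((\<Union>x\<in>C. Q x) \<inter> D c)) = \<sigma>"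
        using \<sigma> unfolding admissible_def
        by (intro extensionalityI[of _ C]) (auto simp: * Qc PiE_def simp del: Union_iff)
      show "(\<lambda>c\<in>C. (\<Union>x\<in>C. Q x) \<inter> D c) = Q"
        using Q by (intro extensionalityI[of _ C]) (auto simp: * PiE_def simp del: UN_iff Int_iff)
    qed
  next
    show "(\<lambda>P. (\<lambda>c\<in>C. \<Union> (P \<inter> D c), \<lambda>c\<in>C. P \<inter> D c)) `
        {P. perfect_matching (span_graph (\<Union>c\<in>C. D c) V) P}
        \<subseteq> (SIGMA \<sigma> : admissible C D V. Pi\<^sub>E C (\<lambda>c. T c (\<sigma> c)))"
    proof (rule image_subsetI, unfold mem_Collect_eq)
      fix P assume "perfect_matching (span_graph (\<Union>c\<in>C. D c) V) P"
      hence P: "P \<subseteq> (\<Union>c\<in>C. D c)" "\<Union> P = V"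
        and uniq: "\<And>v e e'. \<lbrakk>e \<in> P; e' \<in> P; v \<in> e; v \<in> e'\<rbrakk> \<Longrightarrow> e = e'"
        unfolding perfect_matching_span by blast+
      have "card {c \<in> C. v \<in> (\<lambda>c\<in>C. \<Union> (P \<inter> D c)) c} = of_bool (v \<in> V)" for v
      proof (cases "v \<in> V")
        case True
        then obtain e where e: "e \<in> P" "v \<in> e" using P by blast
        then obtain c0 where c0: "c0 \<in> C" "e \<in> D c0" using P by blast
        have "{c \<in> C. v \<in> (\<lambda>c\<in>C. \<Union> (P \<inter> D c)) c} = {c0}"
          using e c0 uniq disj unfolding disjoint_family_on_def by fastforce
        thus ?thesis using True by simp
      next
        case False
        hence "{c \<in> C. v \<in> (\<lambda>c\<in>C. \<Union> (P \<inter> D c)) c} = {}" using P by auto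
        thus ?thesis using False by simp
      qed
      hence "(\<lambda>c\<in>C. \<Union> (P \<inter> D c)) \<in> admissible C D V"
        unfolding admissible_def by auto
      moreover have "P \<inter> D c \<in> T c (\<Union> (P \<inter> D c))" for c
        unfolding T_def perfect_matching_span using uniq by blast
      ultimately show "(\<lambda>c\<in>C. \<Union> (P \<inter> D c), \<lambda>c\<in>C. P \<inter> D c)
          \<in> (SIGMA \<sigma> : admissible C D V. Pi\<^sub>E C (\<lambda>c. T c (\<sigma> c)))"
        by (simp add: restrict_PiE_iff)
    qed
  next
    show "(\<lambda>(\<sigma>, Q). \<Union>c\<in>C. Q c) ` (SIGMA \<sigma> : admissible C D V. Pi\<^sub>E C (\<lambda>c. T c (\<sigma> c)))
        \<subseteq> {P. perfect_matching (span_graph (\<Union>c\<in>C. D c) V) P}"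
    proof (rule image_subsetI)
      fix x assume "x \<in> (SIGMA \<sigma> : admissible C D V. Pi\<^sub>E C (\<lambda>c. T c (\<sigma> c)))"
      then obtain \<sigma> Q where x: "x = (\<sigma>, Q)" and \<sigma>: "\<sigma> \<in> admissible C D V"
        and Q: "Q \<in> Pi\<^sub>E C (\<lambda>c. T c (\<sigma> c))" by blast
      have Qc: "Q c \<subseteq> D c" "\<Union> (Q c) = \<sigma> c"
          "\<And>v e e'. \<lbrakk>e \<in> Q c; e' \<in> Q c; v \<in> e; v \<in> e'\<rbrakk> \<Longrightarrow> e = e'" if "c \<in> C" for c
        using PiE_mem[OF Q that] unfolding T_def perfect_matching_span by blast+
      have cd: "card {c \<in> C. v \<in> \<sigma> c} = of_bool (v \<in> V)" for v
        using \<sigma> unfolding admissible_def by blast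
      have inV: "v \<in> V \<longleftrightarrow> (\<exists>c\<in>C. v \<in> \<sigma> c)" for v
        using cd[of v] C by (cases "v \<in> V") (auto simp: card_1_singleton_iff)
      \<comment> \<open>Multiplicity at most 1 means that parts from different blocks never share a
        vertex, so their union is again a matching.\<close>
      have same: "c = c'" if "c \<in> C" "c' \<in> C" "v \<in> \<sigma> c" "v \<in> \<sigma> c'" for c c' v
      proof -
        have "card {c \<in> C. v \<in> \<sigma> c} \<le> 1" using cd[of v] by simp
        thus ?thesis using C that by (auto simp: card_le_Suc0_iff_eq)
      qed
      show "(case x of (\<sigma>, Q) \<Rightarrow> \<Union>c\<in>C. Q c) \<in> {P. perfect_matching (span_graph (\<Union>c\<in>C. D c) V) P}"
        unfolding x prod.case mem_Collect_eq perfect_matching_span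
      proof (intro conjI allI impI)
        show "(\<Union>c\<in>C. Q c) \<subseteq> (\<Union>c\<in>C. D c)" using Qc(1) by blast
        have "\<Union> (\<Union>c\<in>C. Q c) = (\<Union>c\<in>C. \<Union> (Q c))" by blast
        also have "\<dots> = V" using Qc(2) inV by auto
        finally show "\<Union> (\<Union>c\<in>C. Q c) = V" .
        fix v e e' assume h: "e \<in> (\<Union>c\<in>C. Q c)" "e' \<in> (\<Union>c\<in>C. Q c)" "v \<in> e" "v \<in> e'"
        then obtain c c' where c: "c \<in> C" "c' \<in> C" "e \<in> Q c" "e' \<in> Q c'" by blast
        hence "c = c'" using same[of c c' v] Qc(2)[OF c(1)] Qc(2)[OF c(2)] h by blast
        thus "e = e'" using Qc(3)[OF c(1), of e e' v] c h by blast
      qed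
    qed
  qed
  hence "num_perfect_matchings (span_graph (\<Union>c\<in>C. D c) V) =
      card (SIGMA \<sigma> : admissible C D V. Pi\<^sub>E C (\<lambda>c. T c (\<sigma> c)))"
    unfolding num_perfect_matchings_def by (rule bij_betw_same_card)
  also have "\<dots> = (\<Sum>\<sigma> \<in> admissible C D V. card (Pi\<^sub>E C (\<lambda>c. T c (\<sigma> c))))"
    using adm_fin C T_fin by (intro card_SigmaI) (auto intro!: finite_PiE)
  also have "\<dots> = (\<Sum>\<sigma> \<in> admissible C D V. \<Prod>c\<in>C. card (T c (\<sigma> c)))"
    using C by (simp add: card_PiE)
  finally show ?thesis unfolding T_def num_perfect_matchings_def .
qed

section \<open>Matchings inside a single 4-cycle\<close>

definition four_cycle :: "'a set set \<Rightarrow> bool" where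
  "four_cycle E \<longleftrightarrow> (\<exists>p q r s. distinct [p, q, r, s] \<and> E = {{p, q}, {q, r}, {r, s}, {s, p}})"

text \<open>Only the cyclic intersection pattern matters: the pairwise disjoint subfamilies are the
  empty one, the singletons and the two pairs of opposite edges. Keeping the edges opaque spares a
  case analysis on endpoints.\<close>

lemma perfect_matchings_four_edges:
  assumes "distinct [e, f, g, h]" and meet: "e \<inter> f \<noteq> {}" "f \<inter> g \<noteq> {}" "g \<inter> h \<noteq> {}" "h \<inter> e \<noteq> {}"
    and disj: "e \<inter> g = {}" "f \<inter> h = {}"
  shows "{Q. perfect_matching (span_graph {e, f, g, h} S) Q} =
    {Q \<in> {{}, {e}, {f}, {g}, {h}, {e, g}, {f, h}}. \<Union> Q = S}" (is "?L = ?R")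
proof
  show "?L \<subseteq> ?R"
  proof
    fix Q assume "Q \<in> ?L"
    hence Q: "Q \<subseteq> {e, f, g, h}" "\<Union> Q = S"
      and "\<forall>v x y. x \<in> Q \<longrightarrow> y \<in> Q \<longrightarrow> v \<in> x \<longrightarrow> v \<in> y \<longrightarrow> x = y"
      unfolding mem_Collect_eq perfect_matching_span by simp_all
    hence excl: "\<not> (x \<in> Q \<and> y \<in> Q)" if "x \<noteq> y" "x \<inter> y \<noteq> {}" for x y
      using that by blast
    have "\<not> (e \<in> Q \<and> f \<in> Q)" "\<not> (f \<in> Q \<and> g \<in> Q)" "\<not> (g \<in> Q \<and> h \<in> Q)" "\<not> (h \<in> Q \<and> e \<in> Q)"
      using excl[of e f] excl[of f g] excl[of g h] excl[of h e] meet assms(1) by auto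
    moreover have "Q = (if e \<in> Q then {e} else {}) \<union> (if f \<in> Q then {f} else {}) \<union>
        (if g \<in> Q then {g} else {}) \<union> (if h \<in> Q then {h} else {})"
      using Q(1) by auto
    ultimately have "Q \<in> {{}, {e}, {f}, {g}, {h}, {e, g}, {f, h}}"
      by (cases "e \<in> Q"; cases "f \<in> Q"; cases "g \<in> Q"; cases "h \<in> Q"; simp add: doubleton_eq_iff)
    thus "Q \<in> ?R" using Q(2) by simp
  qed
  show "?R \<subseteq> ?L"
  proof
    fix Q assume "Q \<in> ?R"
    hence Q: "Q \<in> {{}, {e}, {f}, {g}, {h}, {e, g}, {f, h}}" "\<Union> Q = S" by simp_all
    have "Q \<subseteq> {e, f, g, h}"
      using Q(1) by (elim insertE emptyE) simp_all
    moreover have "\<forall>x\<in>Q. \<forall>y\<in>Q. x \<noteq> y \<longrightarrow> x \<inter> y = {}"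
      using Q(1) disj by (elim insertE emptyE) (simp_all add: Int_commute)
    ultimately show "Q \<in> ?L"
      unfolding mem_Collect_eq perfect_matching_span using Q(2) by (intro conjI) blast+
  qed
qed

text \<open>The coefficient 2 arises because either pair of opposite edges covers all four vertices;
  every other coverable set is covered in one way.\<close>

lemma four_cycle_matchings:
  assumes "distinct [p, q, r, s]"
  shows "num_perfect_matchings (span_graph {{p, q}, {q, r}, {r, s}, {s, p}} S) =
    of_bool (S = {}) + of_bool (S = {p, q}) + of_bool (S = {q, r}) + of_bool (S = {r, s})
      + of_bool (S = {s, p}) + 2 * of_bool (S = {p, q, r, s})"
proof -
  have edges: "{p, q} \<noteq> {q, r}" "{p, q} \<noteq> {r, s}" "{p, q} \<noteq> {s, p}" "{q, r} \<noteq> {r, s}"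
      "{q, r} \<noteq> {s, p}" "{r, s} \<noteq> {s, p}"
    using assms by (auto simp: doubleton_eq_iff)
  have "{Q. perfect_matching (span_graph {{p, q}, {q, r}, {r, s}, {s, p}} S) Q} =
      {Q \<in> {{}, {{p, q}}, {{q, r}}, {{r, s}}, {{s, p}}, {{p, q}, {r, s}}, {{q, r}, {s, p}}}.
        \<Union> Q = S}"
    by (rule perfect_matchings_four_edges) (use edges assms in auto)
  hence "num_perfect_matchings (span_graph {{p, q}, {q, r}, {r, s}, {s, p}} S) =
     card {Q \<in> {{}, {{p, q}}, {{q, r}}, {{r, s}}, {{s, p}}, {{p, q}, {r, s}}, {{q, r}, {s, p}}}.
        \<Union> Q = S}"
    unfolding num_perfect_matchings_def by (rule arg_cong)
  also have "\<dots> = of_bool (S = {}) + of_bool (S = {p, q}) + of_bool (S = {q, r}) + of_bool (S = {r, s})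
      + of_bool (S = {s, p}) + of_bool (S = {p, q} \<union> {r, s}) + of_bool (S = {q, r} \<union> {s, p})"
  proof -
    have "card {Q \<in> {{}, {e}, {f}, {g}, {h}, {e, g}, {f, h}}. \<Union> Q = S} =
        of_bool (S = {}) + of_bool (S = e) + of_bool (S = f) + of_bool (S = g) + of_bool (S = h)
        + of_bool (S = e \<union> g) + of_bool (S = f \<union> h)"
      if "e \<noteq> f" "e \<noteq> g" "e \<noteq> h" "f \<noteq> g" "f \<noteq> h" "g \<noteq> h" for e f g h :: "'a set"
    proof -
      let ?A = "{{}, {e}, {f}, {g}, {h}, {e, g}, {f, h}}"
      \<comment> \<open>The seven subfamilies are distinct because the edges are, so the sum over
        the set expands into seven terms.\<close>
      have sum_A: "sum F ?A = F {} + F {e} + F {f} + F {g} + F {h} + F {e, g} + F {f, h}"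
        for F :: "'a set set \<Rightarrow> nat"
        using that that[symmetric] by (simp add: doubleton_eq_iff)
      have card_B: "card {Q \<in> B. \<Union> Q = S} = (\<Sum>Q\<in>B. of_bool (S = \<Union> Q))" if "finite B" for B
        using that by (simp add: Collect_conj_eq eq_commute[of S])
      have "card {Q \<in> ?A. \<Union> Q = S} = (\<Sum>Q\<in>?A. of_bool (S = \<Union> Q))" by (rule card_B) simp
      thus ?thesis unfolding sum_A by simp
    qed
    from this[OF edges] show ?thesis .
  qed
  also have "{p, q} \<union> {r, s} = {p, q, r, s}" by blast
  also have "{q, r} \<union> {s, p} = {p, q, r, s}" by blast
  finally show ?thesis by simp
qed

text \<open>The complement of an edge is the opposite edge, with factor 1; the full set against the
  empty set gives 2, and the reverse 1/2. For every other \<open>S\<close> both counts vanish, so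
  the half-integer exponent of an odd \<open>card S\<close> is harmless.\<close>

lemma four_cycle_complement:
  assumes "four_cycle E" "S \<subseteq> \<Union> E"
  shows "real (num_perfect_matchings (span_graph E S)) =
    2 powr (card S / 2 - 1) * real (num_perfect_matchings (span_graph E (\<Union> E - S)))"
proof -
  obtain p q r s where d: "distinct [p, q, r, s]" and E: "E = {{p, q}, {q, r}, {r, s}, {s, p}}"
    using assms unfolding four_cycle_def by blast
  have U: "\<Union> E = {p, q, r, s}" using E by auto
  have comp: "\<Union> E - S = T \<longleftrightarrow> S = {p, q, r, s} - T" if "T \<subseteq> {p, q, r, s}" for T
    using assms that U by blast
  have diffs: "{p, q, r, s} - {p, q} = {r, s}" "{p, q, r, s} - {q, r} = {s, p}"
     "{p, q, r, s} - {r, s} = {p, q}" "{p, q, r, s} - {s, p} = {q, r}"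
    using d by auto
  have c: "num_perfect_matchings (span_graph E (\<Union> E - S)) =
    of_bool (S = {p, q, r, s}) + of_bool (S = {r, s}) + of_bool (S = {s, p}) + of_bool (S = {p, q})
      + of_bool (S = {q, r}) + 2 * of_bool (S = {})"
    using comp[of "{}"] comp[of "{p,q}"] comp[of "{q,r}"] comp[of "{r,s}"] comp[of "{s,p}"]
      comp[of "{p,q,r,s}"] diffs
    unfolding E four_cycle_matchings[OF d] by simp
  have cards: "card {p, q, r, s} = 4" "card {p, q} = 2" "card {q, r} = 2" "card {r, s} = 2"
      "card {s, p} = 2"
    using d by auto
  consider "S = {}" | "S = {p, q, r, s}" | "S = {p, q} \<or> S = {q, r} \<or> S = {r, s} \<or> S = {s, p}"
    | "S \<noteq> {}" "S \<noteq> {p, q, r, s}" "S \<noteq> {p, q}" "S \<noteq> {q, r}" "S \<noteq> {r, s}" "S \<noteq> {s, p}"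
    by blast
  thus ?thesis
  proof cases
    case 1
    thus ?thesis unfolding c unfolding E four_cycle_matchings[OF d] by (simp add: powr_minus)
  next
    case 2
    have "S \<noteq> {}" "S \<noteq> {p, q}" "S \<noteq> {q, r}" "S \<noteq> {r, s}" "S \<noteq> {s, p}"
      using cards 2 by auto
    thus ?thesis unfolding c unfolding E four_cycle_matchings[OF d] using cards 2 by simp
  next
    case 3
    hence "S \<noteq> {}" "S \<noteq> {p, q, r, s}" "card S = 2" using cards by auto
    thus ?thesis unfolding c unfolding E four_cycle_matchings[OF d] by simp
  next
    case 4
    thus ?thesis unfolding c unfolding E four_cycle_matchings[OF d] by simp
  qed
qed

section \<open>Complementation over a family of 4-cycles\<close>

lemma sum_card_eq_if_multiplicity:
  fixes f :: "'a \<Rightarrow> nat"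
  assumes "finite C" "finite U" "\<And>c. c \<in> C \<Longrightarrow> \<sigma> c \<subseteq> U"
    and "\<And>v. v \<in> U \<Longrightarrow> card {c \<in> C. v \<in> \<sigma> c} = f v"
  shows "(\<Sum>c\<in>C. card (\<sigma> c)) = sum f U"
proof -
  have "(\<Sum>c\<in>C. card (\<sigma> c)) = (\<Sum>c\<in>C. card {v \<in> U. v \<in> \<sigma> c})"
    using assms(3) by (intro sum.cong refl arg_cong[of _ _ card]) blast
  also have "\<dots> = sum f U"
    using assms by (intro sum_multicount_gen) auto
  finally show ?thesis .
qed

text \<open>By \<open>deg\<close>, taking complements in all blocks turns multiplicity
  \<open>of_bool (v \<in> V)\<close> into \<open>of_bool (v \<in> V')\<close>, so it is a bijection
  between the admissible families. The local factors multiply to 2^(|V|/2 - |C|), which is the same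
  for every family.\<close>

lemma complementation:
  fixes C :: "'c set" and D :: "'c \<Rightarrow> 'a set set"
  assumes C: "finite C" and disj: "disjoint_family_on D C"
    and cyc: "\<And>c. c \<in> C \<Longrightarrow> four_cycle (D c)"
    and deg: "\<And>v. card {c \<in> C. v \<in> \<Union> (D c)} = of_bool (v \<in> V) + of_bool (v \<in> V')"
  shows "real (num_perfect_matchings (span_graph (\<Union>c\<in>C. D c) V)) =
    2 powr ((real (card V) - real (card V')) / 4) *
    real (num_perfect_matchings (span_graph (\<Union>c\<in>C. D c) V'))"
proof -
  define U where "U = (\<Union>c\<in>C. \<Union> (D c))"
  have fin: "finite (D c)" "finite (\<Union> (D c))" "card (\<Union> (D c)) = 4" if "c \<in> C" for c
    using cyc[OF that] unfolding four_cycle_def by (auto simp: card_insert_if)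
  have U: "finite U" unfolding U_def using C fin by blast
  have VU: "V \<subseteq> U" "V' \<subseteq> U"
  proof -
    have "v \<in> U" if "v \<in> V \<union> V'" for v
    proof -
      have "card {c \<in> C. v \<in> \<Union> (D c)} \<noteq> 0" using that by (subst deg) auto
      hence "{c \<in> C. v \<in> \<Union> (D c)} \<noteq> {}" by (metis card.empty)
      thus ?thesis unfolding U_def by blast
    qed
    thus "V \<subseteq> U" "V' \<subseteq> U" by blast+
  qed
  have sum_of_bool: "(\<Sum>v\<in>U. of_bool (v \<in> W)) = card W" if "W \<subseteq> U" for W
    using U that by (simp add: Int_absorb1)
  \<comment> \<open>Incidences between vertices and 4-cycles are counted in two ways; this
    eliminates |C| from the exponent.\<close>
  have "4 * card C = (\<Sum>c\<in>C. card (\<Union> (D c)))" using fin by simp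
  also have "\<dots> = (\<Sum>v\<in>U. of_bool (v \<in> V) + of_bool (v \<in> V'))"
    using C U deg by (intro sum_card_eq_if_multiplicity) (auto simp: U_def)
  also have "\<dots> = card V + card V'" using VU by (simp only: sum.distrib sum_of_bool)
  finally have cardC: "4 * card C = card V + card V'" .
  have split: "card {c \<in> C. v \<in> \<Union> (D c)} = card {c \<in> C. v \<in> \<sigma> c} + card {c \<in> C. v \<in> \<Union> (D c) - \<sigma> c}"
    if "\<sigma> \<in> Pi\<^sub>E C (\<lambda>c. Pow (\<Union> (D c)))" for \<sigma> v
  proof -
    have "{c \<in> C. v \<in> \<Union> (D c)} = {c \<in> C. v \<in> \<sigma> c} \<union> {c \<in> C. v \<in> \<Union> (D c) - \<sigma> c}"
      using that by (auto dest: PiE_mem)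
    also have "card \<dots> = card {c \<in> C. v \<in> \<sigma> c} + card {c \<in> C. v \<in> \<Union> (D c) - \<sigma> c}"
      using C by (intro card_Un_disjoint) auto
    finally show ?thesis .
  qed
  \<comment> \<open>Stated for arbitrary \<open>X\<close> and \<open>Y\<close>, since it is needed
    from \<open>V\<close> to \<open>V'\<close> and back.\<close>
  have flip: "(\<lambda>c\<in>C. \<Union> (D c) - \<sigma> c) \<in> admissible C D Y"
    if "\<sigma> \<in> admissible C D X" "\<And>v. card {c \<in> C. v \<in> \<Union> (D c)} = of_bool (v \<in> X) + of_bool (v \<in> Y)"
    for \<sigma> X Y
  proof -
    have "card {c \<in> C. v \<in> \<Union> (D c) - \<sigma> c} = of_bool (v \<in> Y)" for v
      using that split[of \<sigma> v] by (simp add: admissible_def)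
    thus ?thesis unfolding admissible_def by (simp cong: conj_cong)
  qed
  have flip_flip: "(\<lambda>c\<in>C. \<Union> (D c) - (\<lambda>c\<in>C. \<Union> (D c) - \<sigma> c) c) = \<sigma>" if "\<sigma> \<in> admissible C D X" for \<sigma> X
  proof (rule extensionalityI[of _ C])
    show "\<sigma> \<in> extensional C" using that unfolding admissible_def by (auto simp: PiE_def)
    fix c assume "c \<in> C"
    moreover from this have "\<sigma> c \<subseteq> \<Union> (D c)" using that unfolding admissible_def by auto
    ultimately show "(\<lambda>c\<in>C. \<Union> (D c) - (\<lambda>c\<in>C. \<Union> (D c) - \<sigma> c) c) c = \<sigma> c" by auto
  qed auto
  have prod: "real (\<Prod>c\<in>C. num_perfect_matchings (span_graph (D c) (\<sigma> c))) =
      2 powr ((real (card V) - real (card V')) / 4) *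
      real (\<Prod>c\<in>C. num_perfect_matchings (span_graph (D c) (\<Union> (D c) - \<sigma> c)))"
    if \<sigma>: "\<sigma> \<in> admissible C D V" for \<sigma>
  proof -
    have sub: "\<sigma> c \<subseteq> \<Union> (D c)" if "c \<in> C" for c
      using \<sigma> that unfolding admissible_def by auto
    have "(\<Sum>c\<in>C. card (\<sigma> c)) = (\<Sum>v\<in>U. of_bool (v \<in> V))"
      using C U sub \<sigma> by (intro sum_card_eq_if_multiplicity) (fastforce simp: U_def admissible_def)+
    also have "\<dots> = card V" using VU by (simp only: sum_of_bool)
    finally have "(\<Sum>c\<in>C. real (card (\<sigma> c))) = real (card V)"
      by (metis of_nat_sum)
    hence "(\<Sum>c\<in>C. real (card (\<sigma> c)) / 2 - 1) = real (card V) / 2 - real (card C)"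
      by (simp add: sum_subtractf flip: sum_divide_distrib)
    also have "\<dots> = (real (card V) - real (card V')) / 4"
      using arg_cong[OF cardC, of real] by (simp add: field_simps)
    finally have ex: "(\<Sum>c\<in>C. real (card (\<sigma> c)) / 2 - 1) = (real (card V) - real (card V')) / 4" .
    have "real (\<Prod>c\<in>C. num_perfect_matchings (span_graph (D c) (\<sigma> c))) =
       (\<Prod>c\<in>C. 2 powr (real (card (\<sigma> c)) / 2 - 1) *
          real (num_perfect_matchings (span_graph (D c) (\<Union> (D c) - \<sigma> c))))"
      unfolding of_nat_prod by (intro prod.cong refl four_cycle_complement cyc sub)
    also have "\<dots> = 2 powr (\<Sum>c\<in>C. real (card (\<sigma> c)) / 2 - 1) *
        real (\<Prod>c\<in>C. num_perfect_matchings (span_graph (D c) (\<Union> (D c) - \<sigma> c)))"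
      by (simp add: prod.distrib powr_sum)
    finally show ?thesis unfolding ex .
  qed
  have "real (num_perfect_matchings (span_graph (\<Union>c\<in>C. D c) V)) =
     (\<Sum>\<sigma> \<in> admissible C D V. real (\<Prod>c\<in>C. num_perfect_matchings (span_graph (D c) (\<sigma> c))))"
    using num_perfect_matchings_decompose[OF C disj fin(1,2)] by simp
  also have "\<dots> = (\<Sum>\<sigma> \<in> admissible C D V'. 2 powr ((real (card V) - real (card V')) / 4) *
      real (\<Prod>c\<in>C. num_perfect_matchings (span_graph (D c) (\<sigma> c))))"
  proof (rule sum.reindex_bij_witness[where i = "\<lambda>\<sigma>. \<lambda>c\<in>C. \<Union> (D c) - \<sigma> c"
        and j = "\<lambda>\<sigma>. \<lambda>c\<in>C. \<Union> (D c) - \<sigma> c"])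
    fix \<sigma> assume \<sigma>: "\<sigma> \<in> admissible C D V"
    show "(\<lambda>c\<in>C. \<Union> (D c) - (\<lambda>c\<in>C. \<Union> (D c) - \<sigma> c) c) = \<sigma>" by (rule flip_flip[OF \<sigma>])
    show "(\<lambda>c\<in>C. \<Union> (D c) - \<sigma> c) \<in> admissible C D V'" by (rule flip[OF \<sigma> deg])
    show "2 powr ((real (card V) - real (card V')) / 4) *
        real (\<Prod>c\<in>C. num_perfect_matchings (span_graph (D c) ((\<lambda>c\<in>C. \<Union> (D c) - \<sigma> c) c))) =
        real (\<Prod>c\<in>C. num_perfect_matchings (span_graph (D c) (\<sigma> c)))"
      unfolding prod[OF \<sigma>] by simp
  next
    fix \<sigma> assume \<sigma>: "\<sigma> \<in> admissible C D V'"
    show "(\<lambda>c\<in>C. \<Union> (D c) - (\<lambda>c\<in>C. \<Union> (D c) - \<sigma> c) c) = \<sigma>" by (rule flip_flip[OF \<sigma>])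
    show "(\<lambda>c\<in>C. \<Union> (D c) - \<sigma> c) \<in> admissible C D V" by (rule flip[OF \<sigma>]) (simp only: deg add.commute)
  qed
  also have "\<dots> = 2 powr ((real (card V) - real (card V')) / 4) *
    real (num_perfect_matchings (span_graph (\<Union>c\<in>C. D c) V'))"
    using num_perfect_matchings_decompose[OF C disj fin(1,2)] by (simp add: sum_distrib_left)
  finally show ?thesis .
qed


section \<open>4-cycles around black cells, and odd Aztec rectangles\<close>

definition cell_edges :: "cell \<Rightarrow> cell set set" where
  "cell_edges c = (case c of (i, j) \<Rightarrow>
     {{(i - 1, j), (i, j + 1)}, {(i, j + 1), (i + 1, j)},
      {(i + 1, j), (i, j - 1)}, {(i, j - 1), (i - 1, j)}})"

lemma four_cycle_cell_edges: "four_cycle (cell_edges c)"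
proof -
  obtain i j where "c = (i, j)" by force
  thus ?thesis
    unfolding four_cycle_def cell_edges_def
    by (intro exI[of _ "(i - 1, j)"] exI[of _ "(i, j + 1)"] exI[of _ "(i + 1, j)"] exI[of _ "(i, j - 1)"])
      simp
qed

lemma Union_cell_edges: "\<Union> (cell_edges (i, j)) = {(i - 1, j), (i, j + 1), (i + 1, j), (i, j - 1)}"
  unfolding cell_edges_def by auto

text \<open>Each edge of the cycle joins a cell in the row of the center to a cell in its column.
  The center can therefore be read off from an edge, given which endpoint supplies the row.\<close>

lemma cell_edgesI:
  assumes "\<bar>x - i\<bar> = 1" "\<bar>y - j\<bar> = 1"
  shows "{(i, y), (x, j)} \<in> cell_edges (i, j)"
proof -
  have "x = i - 1 \<or> x = i + 1" "y = j - 1 \<or> y = j + 1" using assms by linarith+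
  thus ?thesis unfolding cell_edges_def by (auto simp: insert_commute)
qed

lemma cell_edgesE:
  assumes "e \<in> cell_edges (i, j)"
  obtains x y where "\<bar>x - i\<bar> = 1" "\<bar>y - j\<bar> = 1" "e = {(i, y), (x, j)}"
proof -
  have "e = {(i, j + 1), (i - 1, j)} \<or> e = {(i, j + 1), (i + 1, j)} \<or>
      e = {(i, j - 1), (i + 1, j)} \<or> e = {(i, j - 1), (i - 1, j)}"
    using assms unfolding cell_edges_def by (simp add: insert_commute, satx)
  thus ?thesis by (elim disjE) (rule that[rotated 2], assumption, simp, simp)+
qed

lemma mem_odd_aztec_rectangle:
  "(i, j) \<in> odd_aztec_rectangle K L (x, y) \<longleftrightarrow>
     \<bar>i - x\<bar> \<le> int K \<and> \<bar>j - y\<bar> \<le> int L \<and> even (i - x + (j - y) + (int K + int L))"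
proof -
  have "(r + t) mod 2 = (int K + int L) mod 2 \<longleftrightarrow> even (r + t + (int K + int L))" for r t
    by presburger
  moreover have "(\<exists>r t. (i, j) = (x + r, y + t) \<and> P r t) \<longleftrightarrow> P (i - x) (j - y)" for P
  proof
    assume "P (i - x) (j - y)"
    thus "\<exists>r t. (i, j) = (x + r, y + t) \<and> P r t"
      by (intro exI[of _ "i - x"] exI[of _ "j - y"]) simp
  qed auto
  ultimately show ?thesis
    unfolding odd_aztec_rectangle_def mem_Collect_eq fst_conv snd_conv by (simp only:)
qed

text \<open>The cells form two interleaved grids of step 2: \<open>f\<close> enumerates the one
  containing the corners, \<open>g\<close> the one strictly inside.\<close>

lemma card_odd_aztec_rectangle: "card (odd_aztec_rectangle K L ctr) = (K + 1) * (L + 1) + K * L"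
proof -
  obtain x y where ctr: "ctr = (x, y)" by force
  define f where "f = (\<lambda>(u::nat, v::nat). (x - int K + 2 * int u, y - int L + 2 * int v))"
  define g where "g = (\<lambda>(u::nat, v::nat). (x - int K + 1 + 2 * int u, y - int L + 1 + 2 * int v))"
  have "odd_aztec_rectangle K L ctr = f ` ({..K} \<times> {..L}) \<union> g ` ({..<K} \<times> {..<L})"
  proof (intro equalityI subsetI)
    fix c assume "c \<in> odd_aztec_rectangle K L ctr"
    then obtain r t where c: "c = (x + r, y + t)" and r: "\<bar>r\<bar> \<le> int K" and t: "\<bar>t\<bar> \<le> int L"
      and par: "(r + t) mod 2 = (int K + int L) mod 2"
      unfolding odd_aztec_rectangle_def ctr by auto
    show "c \<in> f ` ({..K} \<times> {..L}) \<union> g ` ({..<K} \<times> {..<L})"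
    proof (cases "even (r + int K)")
      case True
      hence "even (t + int L)" using par by presburger
      hence "c = f (nat ((r + int K) div 2), nat ((t + int L) div 2))"
        using True r t by (auto simp: f_def c)
      moreover have "nat ((r + int K) div 2) \<le> K" "nat ((t + int L) div 2) \<le> L" using r t by auto
      ultimately show ?thesis by blast
    next
      case False
      hence o: "odd (t + int L)" using par by presburger
      \<comment> \<open>Offsets of the opposite parity cannot attain the extreme values, so the
        second grid is smaller by one in each direction.\<close>
      have b: "\<bar>r\<bar> < int K" "\<bar>t\<bar> < int L" using r t False o by presburger+
      hence "c = g (nat ((r + int K - 1) div 2), nat ((t + int L - 1) div 2))"
        using False o by (auto simp: g_def c)
      moreover have "nat ((r + int K - 1) div 2) < K" "nat ((t + int L - 1) div 2) < L"
        using b by auto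
      ultimately show ?thesis by blast
    qed
  next
    fix c assume "c \<in> f ` ({..K} \<times> {..L}) \<union> g ` ({..<K} \<times> {..<L})"
    then obtain u v where "c = f (u, v) \<and> u \<le> K \<and> v \<le> L \<or> c = g (u, v) \<and> u < K \<and> v < L" by auto
    thus "c \<in> odd_aztec_rectangle K L ctr"
    proof
      assume "c = f (u, v) \<and> u \<le> K \<and> v \<le> L"
      thus ?thesis unfolding odd_aztec_rectangle_def ctr f_def
        by (intro CollectI exI[of _ "2 * int u - int K"] exI[of _ "2 * int v - int L"])
          (auto, presburger)
    next
      assume "c = g (u, v) \<and> u < K \<and> v < L"
      thus ?thesis unfolding odd_aztec_rectangle_def ctr g_def
        by (intro CollectI exI[of _ "2 * int u + 1 - int K"] exI[of _ "2 * int v + 1 - int L"])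
          (auto, presburger)
    qed
  qed
  moreover have "f ` ({..K} \<times> {..L}) \<inter> g ` ({..<K} \<times> {..<L}) = {}"
  proof -
    have "f p \<noteq> g q" for p q unfolding f_def g_def by (cases p; cases q; simp) presburger
    thus ?thesis by blast
  qed
  moreover have "inj_on f A" "inj_on g A" for A
    unfolding f_def g_def by (auto simp: inj_on_def)
  ultimately show ?thesis by (simp add: card_Un_disjoint card_image)
qed

text \<open>Equality would make the sum even. This is how parity turns weak inequalities at the
  boundary of a hole into strict ones.\<close>

lemma odd_add_imp_neq_abs: "odd (w + z) \<Longrightarrow> \<bar>w\<bar> \<noteq> z" for w z :: int
  by presburger

section \<open>The graphs with holes and their common 4-cycles\<close>

text \<open>The \<open>l\<close>-th hole \<open>O\<^bsub>k, a l - k\<^esub>\<close> is centered in row \<open>m + 1\<close> and column \<open>y l\<close>; twice the block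
  \<open>A\<^sub>l\<close>, shifted by 2, is \<open>{y l - a l, y l - a l + 2, \<dots>, y l + a l}\<close>.\<close>

locale holey =
  fixes m n s :: nat and a :: "nat \<Rightarrow> nat" and y :: "nat \<Rightarrow> int"
  assumes even_m: "even m"
    and m_eq: "m = n + (\<Sum>l=1..s. (a l + 1))"
    and parity: "l \<in> {1..s} \<Longrightarrow> even (y l + int (a l))"
    and left: "l \<in> {1..s} \<Longrightarrow> int (a l) \<le> y l"
    and right: "l \<in> {1..s} \<Longrightarrow> y l + int (a l) \<le> 2 * int n"
    and sep: "\<lbrakk>l \<in> {1..s}; l' \<in> {1..s}; l \<noteq> l'\<rbrakk> \<Longrightarrow>
      y l + int (a l) + 2 \<le> y l' - int (a l') \<or> y l' + int (a l') + 2 \<le> y l - int (a l)"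
begin

text \<open>The parity condition of the holes is omitted: with \<open>m\<close> and
  \<open>y l + int (a l)\<close> even, it amounts to \<open>odd (i + j)\<close>.\<close>

definition V :: "nat \<Rightarrow> cell set" where
  "V k = {(i, j). int k \<le> i \<and> i \<le> 2 * int m - int k \<and> int k \<le> j \<and> j \<le> 2 * int n - int k \<and>
     odd (i + j) \<and> (\<forall>l\<in>{1..s}. \<bar>i - int m - 1\<bar> \<le> int k \<longrightarrow> int (a l) - int k < \<bar>j - y l\<bar>)}"

definition edges :: "nat \<Rightarrow> cell set set" where
  "edges k = {{p, q} | p q. p \<in> V k \<and> q \<in> V k \<and> diag_adjacent p q}"

text \<open>The hole condition is weak here and strict in \<open>V\<close>: a cell is left out iff both its left and its right
  neighbor lie in the same hole of \<open>G\<^sub>k\<close>.\<close>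

definition centers :: "nat \<Rightarrow> cell set" where
  "centers k = {(i, j). int k < i \<and> i < 2 * int m - int k \<and> int k < j \<and> j < 2 * int n - int k \<and>
     odd (i + int k) \<and> odd (j + int k) \<and>
     (\<forall>l\<in>{1..s}. \<bar>i - int m - 1\<bar> \<le> int k \<longrightarrow> int (a l) - int k \<le> \<bar>j - y l\<bar>)}"

text \<open>The doubled block has length \<open>2 * a l\<close> within columns 0 to 2n, and
  \<open>m\<close> exceeds \<open>n\<close> by at least \<open>a l + 1\<close>. These bounds keep
  the holes clear of the top and bottom borders.\<close>

lemma size_bounds:
  assumes "l \<in> {1..s}"
  shows "a l \<le> n" "2 * a l + 1 \<le> m"
proof -
  show n: "a l \<le> n" using left[OF assms] right[OF assms] by linarith
  have "a l + 1 \<le> (\<Sum>l=1..s. (a l + 1))" using assms by (intro member_le_sum) auto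
  thus "2 * a l + 1 \<le> m" using n m_eq by linarith
qed

lemma finite_centers: "finite (centers k)"
  by (rule finite_subset[of _ "{int k..2 * int m} \<times> {int k..2 * int n}"]) (auto simp: centers_def)

text \<open>An edge determines its center: exactly one endpoint lies in a row of the parity of the
  centers. That endpoint gives the row, the other one the column.\<close>

lemma disjoint_cell_edges: "disjoint_family_on cell_edges (centers k)"
  unfolding disjoint_family_on_def
proof (intro ballI impI, rule ccontr)
  fix c d assume c: "c \<in> centers k" and d: "d \<in> centers k" and "c \<noteq> d"
    and "cell_edges c \<inter> cell_edges d \<noteq> {}"
  moreover obtain i j i' j' where cd: "c = (i, j)" "d = (i', j')" by force
  ultimately obtain e where "e \<in> cell_edges (i, j)" "e \<in> cell_edges (i', j')" by blast
  then obtain x y x' y' where e: "\<bar>x - i\<bar> = 1" "\<bar>x' - i'\<bar> = 1" "{(i, y), (x, j)} = {(i', y'), (x', j')}"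
    by (metis cell_edgesE)
  have "odd (i + int k)" "odd (i' + int k)" using c d unfolding cd centers_def by auto
  hence "odd (i - x')" "even (i - i')" using e(2) by presburger+
  hence "i = i' \<and> j = j'" using e(3) by (auto simp: doubleton_eq_iff)
  thus False using \<open>c \<noteq> d\<close> cd by simp
qed

text \<open>The center is \<open>(i, j')\<close>. Near a hole its admissibility comes from the
  endpoint in its own row when K = k, where the strict inequality absorbs the shift by one column,
  and from the endpoint in its own column when K = k + 1, where the hole is one row taller.\<close>

lemma edge_in_cell:
  assumes K: "K = k \<or> K = k + 1" and V: "(i, j) \<in> V K" "(i', j') \<in> V K"
    and adj: "\<bar>i - i'\<bar> = 1" "\<bar>j - j'\<bar> = 1" and odd: "odd (i + int k)"
  shows "{(i, j), (i', j')} \<in> (\<Union>c\<in>centers k. cell_edges c)"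
proof -
  have odd': "odd (j' + int k)" using V(1) adj(2) odd unfolding V_def by simp presburger
  have "int k \<le> i" "i \<le> 2 * int m - int k" "int k \<le> j'" "j' \<le> 2 * int n - int k"
    using V K unfolding V_def by auto
  \<comment> \<open>The row and column of the center have the parity of k + 1, hence cannot lie on
    the border of the frame.\<close>
  hence "int k < i" "i < 2 * int m - int k" "int k < j'" "j' < 2 * int n - int k"
    using odd odd' by (auto simp: less_le)
  moreover have "int (a l) - int k \<le> \<bar>j' - y l\<bar>" if "l \<in> {1..s}" "\<bar>i - int m - 1\<bar> \<le> int k" for l
    using K
  proof
    assume "K = k"
    hence "int (a l) - int k < \<bar>j - y l\<bar>" using V(1) that unfolding V_def by simp
    thus ?thesis using adj(2) by linarith
  next
    assume [simp]: "K = k + 1"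
    have "\<bar>i' - int m - 1\<bar> \<le> int K" using that adj(1) by simp
    hence "int (a l) - int K < \<bar>j' - y l\<bar>" using V(2) that(1) unfolding V_def by simp
    thus ?thesis by simp
  qed
  ultimately have "(i, j') \<in> centers k" using odd odd' unfolding centers_def by simp
  moreover have "{(i, j), (i', j')} \<in> cell_edges (i, j')"
    by (rule cell_edgesI) (use adj in linarith)+
  ultimately show ?thesis by blast
qed

text \<open>Consecutive graphs are thus spanned by their vertices in one and the same union of
  4-cycles, as \<open>complementation\<close> requires.\<close>

lemma edges_eq:
  assumes K: "K = k \<or> K = k + 1"
  shows "edges K = {e \<in> (\<Union>c\<in>centers k. cell_edges c). e \<subseteq> V K}"
proof (intro equalityI subsetI)
  fix e assume "e \<in> edges K"
  then obtain i j i' j' where e: "e = {(i, j), (i', j')}" and V: "(i, j) \<in> V K" "(i', j') \<in> V K"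
    and adj: "\<bar>i - i'\<bar> = 1" "\<bar>j - j'\<bar> = 1"
    unfolding edges_def diag_adjacent_def by force
  have "e \<in> (\<Union>c\<in>centers k. cell_edges c)"
  proof (cases "odd (i + int k)")
    case True
    thus ?thesis using edge_in_cell[OF K V adj] e by simp
  next
    case False
    hence "odd (i' + int k)" using adj(1) by presburger
    hence "{(i', j'), (i, j)} \<in> (\<Union>c\<in>centers k. cell_edges c)"
      using adj by (intro edge_in_cell[OF K V(2) V(1)]) linarith+
    thus ?thesis unfolding e by (simp only: insert_commute)
  qed
  thus "e \<in> {e \<in> (\<Union>c\<in>centers k. cell_edges c). e \<subseteq> V K}" using e V by simp
next
  fix e assume "e \<in> {e \<in> (\<Union>c\<in>centers k. cell_edges c). e \<subseteq> V K}"
  then obtain i j where "e \<in> cell_edges (i, j)" and V: "e \<subseteq> V K" by auto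
  then obtain x y where "\<bar>x - i\<bar> = 1" "\<bar>y - j\<bar> = 1" "e = {(i, y), (x, j)}" by (metis cell_edgesE)
  thus "e \<in> edges K" using V unfolding edges_def diag_adjacent_def
    by (intro CollectI exI[of _ "(i, y)"] exI[of _ "(x, j)"]) auto
qed

section \<open>Number of 4-cycles through a cell\<close>

text \<open>Here the cycles are centered to the left and right of the cell. Passing from k to k + 1
  shortens a hole at both ends: an end cell of the old hole joins \<open>V (k + 1)\<close>, unless
  the border excludes it, and lies on the outer cycle only. At the left and right borders cells are
  lost instead.\<close>

lemma degree_horizontal:
  assumes k: "\<forall>l\<in>{1..s}. k < a l" "s \<ge> 1" and i: "odd (i + int k)" and j: "even (j + int k)"
  shows "of_bool ((i, j - 1) \<in> centers k) + of_bool ((i, j + 1) \<in> centers k) =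
    of_bool ((i, j) \<in> V k) + (of_bool ((i, j) \<in> V (k + 1)) :: nat)"
proof -
  have one: "1 \<in> {1..s}" using k(2) by simp
  have kn: "k < n" using bspec[OF k(1) one] size_bounds(1)[OF one] by simp
  \<comment> \<open>In rows of this parity, the holes for k and for k + 1 occupy the same
    rows.\<close>
  have "odd (i - int m - 1 + (int k + 1))" using i even_m by simp
  hence "\<bar>i - int m - 1\<bar> \<noteq> int k + 1" by (rule odd_add_imp_neq_abs)
  hence rows: "\<bar>i - int m - 1\<bar> \<le> int k + 1 \<longleftrightarrow> \<bar>i - int m - 1\<bar> \<le> int k" by auto
  have irange: "i \<noteq> int k" "i \<noteq> 2 * int m - int k" using i by auto
  have jpar: "j \<noteq> int k + 1" "j \<noteq> int k - 1" "j \<noteq> 2 * int n - int k - 1" "j \<noteq> 2 * int n - int k + 1"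
    using j by auto
  let ?I = "int k < i \<and> i < 2 * int m - int k"
  define H where "H f \<longleftrightarrow> (\<forall>l\<in>{1..s}. \<bar>i - int m - 1\<bar> \<le> int k \<longrightarrow> f l)" for f
  have C1: "(i, j - 1) \<in> centers k \<longleftrightarrow> ?I \<and> int k + 2 \<le> j \<and> j \<le> 2 * int n - int k \<and>
      H (\<lambda>l. int (a l) - int k \<le> \<bar>j - 1 - y l\<bar>)"
    using i j unfolding centers_def H_def by auto
  have C2: "(i, j + 1) \<in> centers k \<longleftrightarrow> ?I \<and> int k \<le> j \<and> j + 2 \<le> 2 * int n - int k \<and>
      H (\<lambda>l. int (a l) - int k \<le> \<bar>j + 1 - y l\<bar>)"
    using i j jpar unfolding centers_def H_def by auto
  have V1: "(i, j) \<in> V k \<longleftrightarrow> ?I \<and> int k \<le> j \<and> j \<le> 2 * int n - int k \<and>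
      H (\<lambda>l. int (a l) - int k < \<bar>j - y l\<bar>)"
    using i j irange unfolding V_def H_def by auto
  have V2: "(i, j) \<in> V (k + 1) \<longleftrightarrow> ?I \<and> int k + 2 \<le> j \<and> j + 2 \<le> 2 * int n - int k \<and>
      H (\<lambda>l. int (a l) - int k \<le> \<bar>j - y l\<bar>)"
    using i j jpar rows unfolding V_def H_def by (auto simp: algebra_simps)
  show ?thesis
  proof (cases "\<bar>i - int m - 1\<bar> \<le> int k \<and> (\<exists>l\<in>{1..s}. \<bar>j - y l\<bar> \<le> int (a l) - int k)")
    case True
    then obtain l where l: "l \<in> {1..s}" and jl: "\<bar>j - y l\<bar> \<le> int (a l) - int k"
      and il: "\<bar>i - int m - 1\<bar> \<le> int k" by blast
    \<comment> \<open>The gap between blocks leaves at most one hole near the cell; the margin 2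
      also covers the neighbors in columns j - 1 and j + 1.\<close>
    have other: "int (a l') - int k + 2 \<le> \<bar>j - y l'\<bar>" if "l' \<in> {1..s}" "l' \<noteq> l" for l'
      using sep[OF that(1) l that(2)] jl by linarith
    have H: "H f \<longleftrightarrow> f l" if "\<And>l'. int (a l') - int k + 2 \<le> \<bar>j - y l'\<bar> \<Longrightarrow> f l'" for f
      unfolding H_def using il l other that by metis
    have h: "H (\<lambda>l. int (a l) - int k \<le> \<bar>j - 1 - y l\<bar>) \<longleftrightarrow> int (a l) - int k \<le> \<bar>j - 1 - y l\<bar>"
      "H (\<lambda>l. int (a l) - int k \<le> \<bar>j + 1 - y l\<bar>) \<longleftrightarrow> int (a l) - int k \<le> \<bar>j + 1 - y l\<bar>"
      "H (\<lambda>l. int (a l) - int k < \<bar>j - y l\<bar>) \<longleftrightarrow> int (a l) - int k < \<bar>j - y l\<bar>"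
      "H (\<lambda>l. int (a l) - int k \<le> \<bar>j - y l\<bar>) \<longleftrightarrow> int (a l) - int k \<le> \<bar>j - y l\<bar>"
      by (rule H; linarith)+
    have "odd (j - y l + (int (a l) - int k - 1))" using parity[OF l] j by auto
    hence "\<bar>j - y l\<bar> \<noteq> int (a l) - int k - 1" by (rule odd_add_imp_neq_abs)
    \<comment> \<open>The cell is the right end, the left end, or an inner cell of the hole in its
      row.\<close>
    with jl consider "j - y l = int (a l) - int k" | "j - y l = - (int (a l) - int k)"
      | "\<bar>j - y l\<bar> \<le> int (a l) - int k - 2" by linarith
    thus ?thesis
      using bspec[OF k(1) l] left[OF l] right[OF l] jpar kn unfolding C1 C2 V1 V2 h
      by cases auto
  next
    case False
    have "H (\<lambda>l. int (a l) - int k < \<bar>j - y l\<bar>)" unfolding H_def using False by force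
    moreover from this have "H (\<lambda>l. int (a l) - int k \<le> \<bar>j - 1 - y l\<bar>)"
        "H (\<lambda>l. int (a l) - int k \<le> \<bar>j + 1 - y l\<bar>)" "H (\<lambda>l. int (a l) - int k \<le> \<bar>j - y l\<bar>)"
      unfolding H_def by force+
    ultimately show ?thesis
      using jpar kn unfolding C1 C2 V1 V2 by auto
  qed
qed

text \<open>Here the cycles are centered above and below the cell. Passing from k to k + 1 makes a
  hole one row taller on each side: a cell in such a new row leaves the graph and lies only on the
  cycle pointing away from the hole.\<close>

lemma degree_vertical:
  assumes k: "\<forall>l\<in>{1..s}. k < a l" "s \<ge> 1" and i: "even (i + int k)" and j: "odd (j + int k)"
  shows "of_bool ((i - 1, j) \<in> centers k) + of_bool ((i + 1, j) \<in> centers k) =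
    of_bool ((i, j) \<in> V k) + (of_bool ((i, j) \<in> V (k + 1)) :: nat)"
proof -
  have one: "1 \<in> {1..s}" using k(2) by simp
  have "2 * k + 3 \<le> m" using bspec[OF k(1) one] size_bounds(2)[OF one] by simp
  \<comment> \<open>For a cell in row m + k + 2, just past the hole, the outer center must still be
    inside the frame, which needs exactly this bound; evenness of \<open>m\<close> supplies the last
    unit.\<close>
  hence mk: "2 * k + 4 \<le> m" using even_m by presburger
  define w where "w = i - int m - 1"
  have w: "odd (w + int k)" unfolding w_def using i even_m by simp
  have jrange: "j \<noteq> int k" "j \<noteq> 2 * int n - int k" using j by auto
  have ipar: "i \<noteq> int k + 1" "i \<noteq> int k - 1" "i \<noteq> 2 * int m - int k - 1" "i \<noteq> 2 * int m - int k + 1"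
    using i by auto
  have wpar: "w \<noteq> int k" "w \<noteq> - int k" using w by auto
  have jpar: "\<bar>j - y l\<bar> \<noteq> int (a l) - int k" if "l \<in> {1..s}" for l
  proof -
    have "odd (j - y l + (int (a l) - int k))" using parity[OF that] j by auto
    thus ?thesis by (rule odd_add_imp_neq_abs)
  qed
  let ?J = "int k < j \<and> j < 2 * int n - int k"
  define H where "H \<longleftrightarrow> (\<forall>l\<in>{1..s}. int (a l) - int k \<le> \<bar>j - y l\<bar>)"
  \<comment> \<open>Equality is excluded by parity in these columns, so the hole conditions for
    centers, \<open>V k\<close> and \<open>V (k + 1)\<close> all reduce to \<open>H\<close>.\<close>
  have H': "H \<longleftrightarrow> (\<forall>l\<in>{1..s}. int (a l) - int k < \<bar>j - y l\<bar>)"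
    unfolding H_def using jpar by (force simp: less_le)
  have C1: "(i - 1, j) \<in> centers k \<longleftrightarrow> int k + 2 \<le> i \<and> i \<le> 2 * int m - int k \<and> ?J \<and>
      (\<bar>w - 1\<bar> \<le> int k \<longrightarrow> H)"
    using i j unfolding centers_def H_def w_def by (auto simp: algebra_simps)
  have C2: "(i + 1, j) \<in> centers k \<longleftrightarrow> int k \<le> i \<and> i + 2 \<le> 2 * int m - int k \<and> ?J \<and>
      (\<bar>w + 1\<bar> \<le> int k \<longrightarrow> H)"
    using i j ipar unfolding centers_def H_def w_def by (auto simp: algebra_simps)
  have V1: "(i, j) \<in> V k \<longleftrightarrow> int k \<le> i \<and> i \<le> 2 * int m - int k \<and> ?J \<and> (\<bar>w\<bar> \<le> int k \<longrightarrow> H)"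
    using i j jrange unfolding V_def H' w_def by auto
  have V2: "(i, j) \<in> V (k + 1) \<longleftrightarrow> int k + 2 \<le> i \<and> i + 2 \<le> 2 * int m - int k \<and> ?J \<and>
      (\<bar>w\<bar> \<le> int k + 1 \<longrightarrow> H)"
    using i j ipar unfolding V_def H_def w_def by (auto simp: algebra_simps)
  show ?thesis
  proof (cases H)
    case True
    thus ?thesis using mk ipar unfolding C1 C2 V1 V2 by auto
  next
    case False
    have iw: "i = w + int m + 1" by (simp add: w_def)
    consider "w = int k + 1" | "w = - int k - 1" | "\<bar>w\<bar> < int k" | "\<bar>w\<bar> > int k + 1"
      using wpar by linarith
    thus ?thesis
      using False mk ipar unfolding C1 C2 V1 V2 by cases (auto simp: iw)
  qed
qed

lemma degree:
  assumes k: "\<forall>l\<in>{1..s}. k < a l" "s \<ge> 1"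
  shows "card {c \<in> centers k. v \<in> \<Union> (cell_edges c)} = of_bool (v \<in> V k) + of_bool (v \<in> V (k + 1))"
proof -
  obtain i j where v: "v = (i, j)" by force
  have two: "card (A \<inter> {p, q}) = of_bool (p \<in> A) + of_bool (q \<in> A)" if "p \<noteq> q" for A and p q :: cell
    using that by (auto simp: Int_insert_right)
  have *: "{c \<in> centers k. v \<in> \<Union> (cell_edges c)} =
      centers k \<inter> {(i - 1, j), (i + 1, j), (i, j - 1), (i, j + 1)}"
  proof -
    have "v \<in> \<Union> (cell_edges c) \<longleftrightarrow> c \<in> {(i - 1, j), (i + 1, j), (i, j - 1), (i, j + 1)}" for c
      unfolding v by (cases c) (simp only: Union_cell_edges, auto)
    thus ?thesis by blast
  qed
  have C: "odd (i + int k) \<and> odd (j + int k)" if "(i, j) \<in> centers k" for i j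
    using that by (simp add: centers_def)
  consider "even (i + j)" | "odd (i + int k)" "even (j + int k)" | "even (i + int k)" "odd (j + int k)"
    by (cases "odd (i + int k)"; cases "odd (j + int k)"; simp)
  thus ?thesis
  proof cases
    case 1
    have "centers k \<inter> {(i - 1, j), (i + 1, j), (i, j - 1), (i, j + 1)} = {}"
      using 1 by (auto dest!: C)
    moreover have "v \<notin> V k" "v \<notin> V (k + 1)" using 1 by (auto simp: v V_def)
    ultimately show ?thesis unfolding * by simp
  next
    case 2
    have "centers k \<inter> {(i - 1, j), (i + 1, j), (i, j - 1), (i, j + 1)} =
        centers k \<inter> {(i, j - 1), (i, j + 1)}"
      using 2 C[of "i - 1" j] C[of "i + 1" j] by auto
    thus ?thesis unfolding * unfolding v using degree_horizontal[OF k 2] by (simp add: two)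
  next
    case 3
    have "centers k \<inter> {(i - 1, j), (i + 1, j), (i, j - 1), (i, j + 1)} =
        centers k \<inter> {(i - 1, j), (i + 1, j)}"
      using 3 C[of i "j - 1"] C[of i "j + 1"] by auto
    thus ?thesis unfolding * unfolding v using degree_vertical[OF k 3] by (simp add: two)
  qed
qed

section \<open>Passing from k to k + 1, and telescoping\<close>

lemma matchings_step:
  assumes "\<forall>l\<in>{1..s}. k < a l" "s \<ge> 1"
  shows "real (num_perfect_matchings (V k, edges k)) =
    2 powr ((real (card (V k)) - real (card (V (k + 1)))) / 4) *
    real (num_perfect_matchings (V (k + 1), edges (k + 1)))"
proof -
  have "edges k = {e \<in> (\<Union>c\<in>centers k. cell_edges c). e \<subseteq> V k}"
    by (rule edges_eq) simp
  moreover have "edges (k + 1) = {e \<in> (\<Union>c\<in>centers k. cell_edges c). e \<subseteq> V (k + 1)}"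
    by (rule edges_eq) simp
  ultimately show ?thesis
    using complementation[of "centers k" cell_edges "V k" "V (k + 1)", OF finite_centers
        disjoint_cell_edges four_cycle_cell_edges degree[OF assms]]
    by (simp only:)
qed

lemma matchings_telescope:
  assumes "\<forall>l\<in>{1..s}. k \<le> a l" "s \<ge> 1"
  shows "real (num_perfect_matchings (V 0, edges 0)) =
    2 powr ((real (card (V 0)) - real (card (V k))) / 4) *
    real (num_perfect_matchings (V k, edges k))"
  using assms(1)
proof (induction k)
  case (Suc k)
  have lt: "\<forall>l\<in>{1..s}. k < a l" using Suc.prems by auto
  hence le: "\<forall>l\<in>{1..s}. k \<le> a l" by auto
  have "real (num_perfect_matchings (V 0, edges 0)) =
    2 powr ((real (card (V 0)) - real (card (V k))) / 4) *
    (2 powr ((real (card (V k)) - real (card (V (k + 1)))) / 4) *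
    real (num_perfect_matchings (V (k + 1), edges (k + 1))))"
    using Suc.IH[OF le] unfolding matchings_step[of k, OF lt assms(2)] .
  also have "\<dots> = 2 powr ((real (card (V 0)) - real (card (V k))) / 4 +
      (real (card (V k)) - real (card (V (k + 1)))) / 4) *
    real (num_perfect_matchings (V (k + 1), edges (k + 1)))"
    by (simp only: powr_add mult.assoc)
  also have "(real (card (V 0)) - real (card (V k))) / 4 + (real (card (V k)) - real (card (V (k + 1)))) / 4
      = (real (card (V 0)) - real (card (V (k + 1)))) / 4" by (simp add: field_simps)
  finally show ?case by simp
qed simp

section \<open>Identification of the graphs and vertex count\<close>

lemma V_eq:
  assumes "\<forall>l\<in>{1..s}. k \<le> a l"
  shows "V k = white_cells m n \<inter>
    ({(i, j). int k \<le> i \<and> i \<le> 2 * int m - int k \<and> int k \<le> j \<and> j \<le> 2 * int n - int k}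
     - (\<Union>l\<in>{1..s}. odd_aztec_rectangle k (a l - k) (int m + 1, y l)))"
proof -
  have hole: "(i, j) \<in> odd_aztec_rectangle k (a l - k) (int m + 1, y l) \<longleftrightarrow>
      \<bar>i - int m - 1\<bar> \<le> int k \<and> \<bar>j - y l\<bar> \<le> int (a l) - int k"
    if "l \<in> {1..s}" "odd (i + j)" for i j l
  proof -
    have "even (i - (int m + 1) + (j - y l) + (int k + int (a l - k)))"
      using that parity[OF that(1)] even_m bspec[OF assms that(1)] by (auto simp: of_nat_diff)
    thus ?thesis
      unfolding mem_odd_aztec_rectangle using bspec[OF assms that(1)] by (simp add: of_nat_diff algebra_simps)
  qed
  show ?thesis unfolding V_def white_cells_def by (auto simp: hole not_le)
qed

lemma holey_aztec_rectangle_eq: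
  assumes "\<forall>l\<in>{1..s}. k \<le> a l" "\<And>l. l \<in> {1..s} \<Longrightarrow> y l = \<lfloor>2 * c l\<rfloor> - 2"
  shows "holey_aztec_rectangle m n s a c k = (V k, edges k)"
proof -
  have "(\<Union>l\<in>{1..s}. odd_aztec_rectangle k (a l - k) (int m + 1, \<lfloor>2 * c l\<rfloor> - 2)) =
      (\<Union>l\<in>{1..s}. odd_aztec_rectangle k (a l - k) (int m + 1, y l))"
    using assms(2) by simp
  moreover have "{e \<in> {{p, q} | p q. p \<in> W \<and> q \<in> W \<and> adj p q}. e \<subseteq> X} =
      {{p, q} | p q. p \<in> W \<inter> X \<and> q \<in> W \<inter> X \<and> adj p q}" for W X :: "cell set" and adj
    by blast
  ultimately show ?thesis
    unfolding holey_aztec_rectangle_def induced_subgraph_def aztec_rectangle_def edges_def V_eq[OF assms(1)]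
    by (simp only: fst_conv snd_conv)
qed

text \<open>The black cells of the frame themselves form an odd Aztec rectangle, centered at (m, n),
  so one cardinality formula serves both for them and for the holes.\<close>

lemma card_V:
  assumes k: "\<forall>l\<in>{1..s}. k \<le> a l" "s \<ge> 1"
  shows "int (card (V k)) = 2 * (int m - int k) * (int n - int k) + int m + int n - 2 * int k
    - (\<Sum>l=1..s. 2 * int k * (int (a l) - int k) + int (a l) + 1)"
proof -
  let ?R = "{int k..2 * int m - int k} \<times> {int k..2 * int n - int k}"
  let ?B = "odd_aztec_rectangle (m - k) (n - k) (int m, int n)"
  let ?O = "\<lambda>l. odd_aztec_rectangle k (a l - k) (int m + 1, y l)"
  have one: "1 \<in> {1..s}" using k(2) by simp
  have kn: "k \<le> n" and km: "2 * k + 1 \<le> m"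
    using bspec[OF k(1) one] size_bounds[OF one] by linarith+
  have B: "?B = {(i, j) \<in> ?R. even (i + j)}"
    using kn km by (auto simp: mem_odd_aztec_rectangle of_nat_diff)
  \<comment> \<open>The last row m + 1 + k of a hole stays in the frame because 2k + 1 \<le>
    m.\<close>
  have O: "?O l \<subseteq> {(i, j) \<in> ?R. odd (i + j)}" if l: "l \<in> {1..s}" for l
    using l km bspec[OF k(1) l] left[OF l] right[OF l] parity[OF l] even_m
    by (auto simp: mem_odd_aztec_rectangle of_nat_diff)
  have disj: "?O l \<inter> ?O l' = {}" if "l \<in> {1..s}" "l' \<in> {1..s}" "l \<noteq> l'" for l l'
    using sep[OF that] bspec[OF k(1) that(1)] bspec[OF k(1) that(2)]
    by (auto simp: mem_odd_aztec_rectangle of_nat_diff)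
  have V: "V k = (?R - ?B) - (\<Union>l\<in>{1..s}. ?O l)"
    unfolding V_eq[OF k(1)] B white_cells_def by auto
  have fin: "finite ?R" by simp
  have finB: "finite ?B" unfolding B by (rule finite_subset[OF _ fin]) auto
  have finO: "finite (?O l)" if "l \<in> {1..s}" for l
    by (rule finite_subset[OF subset_trans[OF O[OF that]] fin]) auto
  have BR: "?B \<subseteq> ?R" unfolding B by auto
  have "?O l \<subseteq> ?R - ?B" if "l \<in> {1..s}" for l
    unfolding B by (rule subset_trans[OF O[OF that]]) auto
  hence OR: "(\<Union>l\<in>{1..s}. ?O l) \<subseteq> ?R - ?B" by (rule UN_least)
  have "card (V k) = card (?R - ?B) - card (\<Union>l\<in>{1..s}. ?O l)"
    unfolding V by (rule card_Diff_subset[OF _ OR]) (use finO in blast)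
  moreover have "card (\<Union>l\<in>{1..s}. ?O l) \<le> card (?R - ?B)"
    by (rule card_mono[OF _ OR]) (use fin in blast)
  moreover have "card (?R - ?B) = card ?R - card ?B" "card ?B \<le> card ?R"
    by (rule card_Diff_subset[OF finB BR], rule card_mono[OF fin BR])
  moreover have "card (\<Union>l\<in>{1..s}. ?O l) = (\<Sum>l=1..s. card (?O l))"
    using finO disj by (intro card_UN_disjoint) auto
  ultimately have "card (V k) + (\<Sum>l=1..s. card (?O l)) + card ?B = card ?R"
    by linarith
  hence "int (card (V k)) = int (card ?R) - int (card ?B) - int (\<Sum>l=1..s. card (?O l))"
    by linarith
  also have "int (card ?R) = (2 * (int m - int k) + 1) * (2 * (int n - int k) + 1)"
    using kn km by (simp add: algebra_simps)
  also have "int (card ?B) = (int m - int k + 1) * (int n - int k + 1) + (int m - int k) * (int n - int k)"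
  proof -
    have "int (m - k) = int m - int k" "int (n - k) = int n - int k" using kn km by simp_all
    thus ?thesis by (simp only: card_odd_aztec_rectangle of_nat_add of_nat_mult of_nat_1)
  qed
  also have "int (\<Sum>l=1..s. card (?O l)) = (\<Sum>l=1..s. 2 * int k * (int (a l) - int k) + int (a l) + 1)"
    unfolding of_nat_sum
  proof (rule sum.cong[OF refl])
    fix l assume "l \<in> {1..s}"
    hence "int (a l - k) = int (a l) - int k" using k(1) by simp
    hence "int (card (?O l)) = (int k + 1) * (int (a l) - int k + 1) + int k * (int (a l) - int k)"
      by (simp only: card_odd_aztec_rectangle of_nat_add of_nat_mult of_nat_1)
    thus "int (card (?O l)) = 2 * int k * (int (a l) - int k) + int (a l) + 1"
      by (simp add: algebra_simps)
  qed
  finally show ?thesis by (simp add: algebra_simps)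
qed

text \<open>The difference involves \<open>n\<close> and the total of the \<open>a l\<close> only
  through their sum, which is m - s; so only m, s and k remain. Divisibility by 4 makes the final
  exponent an integer.\<close>

lemma card_V_diff:
  assumes k: "\<forall>l\<in>{1..s}. k \<le> a l" "s \<ge> 1"
  shows "int (card (V 0)) - int (card (V k)) =
    4 * (int k * (int m + 1) - int ((k + 1) choose 2) * (int s + 1))"
proof -
  define A where "A = (\<Sum>l=1..s. int (a l))"
  have m: "int m = int n + A + int s" unfolding A_def m_eq by (simp add: sum.distrib)
  have S: "(\<Sum>l=1..s. 2 * int k * (int (a l) - int k) + int (a l) + 1) =
      2 * int k * (A - int k * int s) + A + int s" for k
    unfolding A_def by (simp add: sum.distrib sum_subtractf flip: sum_distrib_left)
  have "2 * ((k + 1) choose 2) = (k + 1) * k" by (simp add: choose_two)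
  hence ch: "2 * int ((k + 1) choose 2) = (int k + 1) * int k"
    by (metis of_nat_1 of_nat_add of_nat_mult of_nat_numeral)
  have V0: "int (card (V 0)) = 2 * int m * int n + int m + int n - A - int s"
    using card_V[of 0] k(2) S[of 0] by simp
  have "int (card (V 0)) - int (card (V k)) =
      4 * int k * (int m + 1) - 2 * (2 * int ((k + 1) choose 2)) * (int s + 1)"
    unfolding card_V[OF k] V0 S ch unfolding m by (simp add: algebra_simps)
  thus ?thesis by (simp add: algebra_simps)
qed

end

section \<open>From half-integer centers to integer coordinates\<close>

theorem theorem3p4:
  fixes m n s k :: nat and a :: "nat \<Rightarrow> nat" and c :: "nat \<Rightarrow> rat"
  assumes "m > 0" and "even m" and "s \<ge> 1"
    and "n = m - (\<Sum>i=1..s. (a i + 1))" and "n \<ge> 1"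
    and "\<And>i. i \<in> {1..s} \<Longrightarrow> 2 * c i \<in> \<int>"
    and "\<And>i. i \<in> {1..s} \<Longrightarrow> c i - of_nat (a i) / 2 \<in> \<int>"
    and "\<And>i. i \<in> {1..s} \<Longrightarrow> centered_block (c i) (a i) \<subseteq> {1..int n + 1}"
    and "disjoint_family_on (\<lambda>i. centered_block (c i) (a i)) {1..s}"
    and "1 \<le> k" and "k \<le> Min (a ` {1..s})"
  shows "real (num_perfect_matchings (holey_aztec_rectangle m n s a c k)) =
    2 powi (int ((k + 1) choose 2) * (int s + 1) - int k * (int m + 1)) *
    real (num_perfect_matchings (holey_aztec_rectangle m n s a c 0))"
proof -
  \<comment> \<open>\<open>p i\<close> is the least element of the i-th block, and
    \<open>y i\<close> the column of the center of its hole.\<close>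
  define p where "p i = \<lfloor>c i - of_nat (a i) / 2\<rfloor>" for i
  define y where "y i = \<lfloor>2 * c i\<rfloor> - 2" for i
  have c: "c i = of_int (p i) + of_nat (a i) / 2" if i: "i \<in> {1..s}" for i
  proof -
    obtain z where "c i - of_nat (a i) / 2 = of_int z"
      using assms(7)[OF i] by (auto elim: Ints_cases)
    thus ?thesis unfolding p_def by (simp add: algebra_simps)
  qed
  have y: "y i = 2 * p i + int (a i) - 2" if "i \<in> {1..s}" for i
  proof -
    have "2 * c i = of_int (2 * p i + int (a i))" using c[OF that] by simp
    thus ?thesis unfolding y_def by (metis floor_of_int)
  qed
  have block: "centered_block (c i) (a i) = {p i..p i + int (a i)}" if "i \<in> {1..s}" for i
  proof -
    have ends: "c i - of_nat (a i) / 2 = of_int (p i)" "c i + of_nat (a i) / 2 = of_int (p i + int (a i))"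
      using c[OF that] by simp_all
    show ?thesis unfolding centered_block_def ends of_int_le_iff by auto
  qed
  interpret holey m n s a y
  proof
    show "even m" by fact
    \<comment> \<open>Since n \<ge> 1, the natural subtraction defining \<open>n\<close> is not
      truncated.\<close>
    show "m = n + (\<Sum>l=1..s. (a l + 1))" using assms(4,5) by simp
    fix l assume l: "l \<in> {1..s}"
    show "even (y l + int (a l))" using y[OF l] by simp
    have "p l \<in> {1..int n + 1}" "p l + int (a l) \<in> {1..int n + 1}"
      using assms(8)[OF l] unfolding block[OF l] by auto
    thus "int (a l) \<le> y l" "y l + int (a l) \<le> 2 * int n" using y[OF l] by auto
    fix l' assume l': "l' \<in> {1..s}" and "l \<noteq> l'"
    hence "{p l..p l + int (a l)} \<inter> {p l'..p l' + int (a l')} = {}"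
      using disjoint_family_onD[OF assms(9) l l'] block l by simp
    \<comment> \<open>Neither block contains the left end of the other, so one ends at least 1
      before the other begins; doubling turns this into the gap 2.\<close>
    hence "p l \<notin> {p l'..p l' + int (a l')}" "p l' \<notin> {p l..p l + int (a l)}" by auto
    thus "y l + int (a l) + 2 \<le> y l' - int (a l') \<or> y l' + int (a l') + 2 \<le> y l - int (a l)"
      unfolding y[OF l] y[OF l'] by auto
  qed
  have k: "\<forall>l\<in>{1..s}. k \<le> a l" using assms(11) by auto
  \<comment> \<open>\<open>N\<close> is a quarter of |V 0| - |V k|, the telescoped exponent for the
    count of \<open>V 0\<close> in terms of \<open>V k\<close>; solving for the latter reverses its
    sign.\<close>
  define N where "N = int k * (int m + 1) - int ((k + 1) choose 2) * (int s + 1)"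
  have "(real (card (V 0)) - real (card (V k))) / 4 = real_of_int N"
    using arg_cong[OF card_V_diff[OF k \<open>s \<ge> 1\<close>], of real_of_int] unfolding N_def by simp
  hence "real (num_perfect_matchings (V 0, edges 0)) =
      2 powi N * real (num_perfect_matchings (V k, edges k))"
    using matchings_telescope[OF k \<open>s \<ge> 1\<close>] by (simp add: powr_real_of_int')
  hence "2 powi (- N) * real (num_perfect_matchings (V 0, edges 0)) =
      real (num_perfect_matchings (V k, edges k))"
    by (simp add: power_int_minus)
  moreover have "- N = int ((k + 1) choose 2) * (int s + 1) - int k * (int m + 1)"
    unfolding N_def by simp
  moreover have "holey_aztec_rectangle m n s a c k = (V k, edges k)"
      "holey_aztec_rectangle m n s a c 0 = (V 0, edges 0)"
    by (rule holey_aztec_rectangle_eq; use k in \<open>simp add: y_def\<close>)+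
  ultimately show ?thesis by (simp only:)
qed

end
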